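(* For every integer $n\geq 2$, the class of all finite $n$-partite tournaments has the extension property for partial automorphisms (EPPA). That is, for every $n \geq 2$ and every finite $n$-partite tournament $G$ there is a finite $n$-partite tournament $H$ containing $G$ as an induced subgraph such that every isomorphism between induced subgraphs of $G$ extends to an automorphism of $H$.
   Context: A directed graph $G=(V,E)$ is an \emph{$n$-partite tournament} if its vertex set can be partitioned into sets $V_1\cup V_2\cup\ldots\cup V_n=V$ (called \emph{parts}) such that every pair of vertices in different parts is connected by exactly one directed edge and there are no edges between vertices in the same part. The parts are not named in the structure: isomorphisms and automorphisms are those of directed graphs, and they may permute the parts. A class $\mathcal{C}$ of finite structures has the \emph{extension property for partial automorphisms} (EPPA) if for every $\mathbf{A}\in\mathcal{C}$ there is $\mathbf{B}\in\mathcal{C}$ (an \emph{EPPA-witness} for $\mathbf{A}$) containing $\mathbf{A}$ as an induced substructure such that every isomorphism of induced substructures of $\mathbf{A}$ (a \emph{partial automorphism} of $\mathbf{A}$) extends to an automorphism of $\mathbf{B}$. *)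

theory Defs
  imports
    "Graph_Theory.Digraph_Component"
    "Graph_Theory.Digraph_Isomorphism"
    "HOL-Library.Disjoint_Sets"
begin

text \<open>
  Parts may be empty. Nothing is lost by this: if a graph has \<open>n\<close> nonempty parts, then so does every
  \<open>n\<close>-partite tournament containing it, since vertices from distinct parts are joined by an edge
  and hence stay in distinct parts.
\<close>

definition partite_tournament :: "nat \<Rightarrow> 'a pair_pre_digraph \<Rightarrow> bool" where
  "partite_tournament n G \<longleftrightarrow>
     pair_wf_digraph G \<and>
     (\<exists>V :: nat \<Rightarrow> 'a set.
        disjoint_family_on V {1..n} \<and> (\<Union>i\<in>{1..n}. V i) = pverts G \<and>
        (\<forall>i\<in>{1..n}. \<forall>u\<in>V i. \<forall>v\<in>V i. (u, v) \<notin> parcs G) \<and>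
        (\<forall>i\<in>{1..n}. \<forall>j\<in>{1..n}. i \<noteq> j \<longrightarrow>
           (\<forall>u\<in>V i. \<forall>v\<in>V j. ((u, v) \<in> parcs G) \<noteq> ((v, u) \<in> parcs G))))"

definition pair_iso :: "('a \<Rightarrow> 'b) \<Rightarrow> 'a pair_pre_digraph \<Rightarrow> 'b pair_pre_digraph \<Rightarrow> bool" where
  "pair_iso f G H \<longleftrightarrow>
     bij_betw f (pverts G) (pverts H) \<and>
     (\<forall>u\<in>pverts G. \<forall>v\<in>pverts G. (u, v) \<in> parcs G \<longleftrightarrow> (f u, f v) \<in> parcs H)"

text \<open>
  The library's isomorphisms also carry a map on arcs; without parallel arcs it is determined by
  the map on vertices.
\<close>

lemma pair_iso_iff_digraph_isomorphism:
  fixes G :: "'a pair_pre_digraph" and H :: "'b pair_pre_digraph" and f :: "'a \<Rightarrow> 'b"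
  assumes "pair_wf_digraph G" "pair_wf_digraph H"
  defines "h \<equiv> \<lparr>iso_verts = f, iso_arcs = map_prod f f, iso_head = snd, iso_tail = fst\<rparr>"
  shows "pair_iso f G H \<longleftrightarrow>
           pre_digraph.digraph_isomorphism (with_proj G) h \<and> with_proj H = app_iso h (with_proj G)"
proof -
  interpret G: pair_wf_digraph G by fact
  interpret H: pair_wf_digraph H by fact
  have wf: "wf_digraph (with_proj G)" by (rule G.wf_digraph)
  have sub: "parcs G \<subseteq> pverts G \<times> pverts G" "parcs H \<subseteq> pverts H \<times> pverts H"
    using G.wellformed' H.wellformed' by auto
  show ?thesis
  proof
    assume iso: "pair_iso f G H"
    then have inj: "inj_on f (pverts G)" and im: "f ` pverts G = pverts H"
      and arc: "\<And>u v. u \<in> pverts G \<Longrightarrow> v \<in> pverts G \<Longrightarrow> (u, v) \<in> parcs G \<longleftrightarrow> (f u, f v) \<in> parcs H"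
      by (auto simp: pair_iso_def bij_betw_def)
    have inj2: "inj_on (map_prod f f) (parcs G)"
      using map_prod_inj_on[OF inj inj] sub(1) by (rule inj_on_subset)
    have "parcs H = map_prod f f ` parcs G"
    proof (rule set_eqI)
      fix e :: "'b \<times> 'b"
      obtain x y where e: "e = (x, y)" by (cases e)
      show "e \<in> parcs H \<longleftrightarrow> e \<in> map_prod f f ` parcs G"
      proof
        assume "e \<in> parcs H"
        moreover from this obtain u v where "u \<in> pverts G" "v \<in> pverts G" "x = f u" "y = f v"
          using sub(2) im e by blast
        ultimately show "e \<in> map_prod f f ` parcs G" using arc e by force
      next
        assume "e \<in> map_prod f f ` parcs G"
        then show "e \<in> parcs H" using arc sub(1) by auto
      qed
    qed
    then show "pre_digraph.digraph_isomorphism (with_proj G) h \<and> with_proj H = app_iso h (with_proj G)"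
      using wf inj inj2 im
      by (auto simp: pre_digraph.digraph_isomorphism_def h_def app_iso_def with_proj_def)
  next
    assume "pre_digraph.digraph_isomorphism (with_proj G) h \<and> with_proj H = app_iso h (with_proj G)"
    then have inj: "inj_on f (pverts G)" and im: "pverts H = f ` pverts G"
      and arcs: "parcs H = map_prod f f ` parcs G"
      by (auto simp: pre_digraph.digraph_isomorphism_def h_def app_iso_def with_proj_def)
    have "(u, v) \<in> parcs G \<longleftrightarrow> (f u, f v) \<in> parcs H" if "u \<in> pverts G" "v \<in> pverts G" for u v
    proof
      assume "(f u, f v) \<in> parcs H"
      then obtain u' v' where "(u', v') \<in> parcs G" "f u = f u'" "f v = f v'"
        using arcs by auto
      then show "(u, v) \<in> parcs G" using that sub(1) inj by (auto dest: inj_onD)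
    qed (use arcs in force)
    then show "pair_iso f G H" using inj im by (auto simp: pair_iso_def bij_betw_def)
  qed
qed

text \<open>
  \<open>B\<close> contains the copy of \<open>A\<close> given by the embedding \<open>f\<close>; this allows \<open>A\<close> to live on a finite type,
  where a proper extension on the same type may not exist.
\<close>

definition EPPA_witness :: "('a \<Rightarrow> 'b) \<Rightarrow> 'a pair_pre_digraph \<Rightarrow> 'b pair_pre_digraph \<Rightarrow> bool" where
  "EPPA_witness f A B \<longleftrightarrow>
     (\<exists>A'. induced_subgraph (with_proj A') (with_proj B) \<and> pair_iso f A A') \<and>
     (\<forall>S T \<phi>. induced_subgraph (with_proj S) (with_proj A) \<and>
        induced_subgraph (with_proj T) (with_proj A) \<and> pair_iso \<phi> S T \<longrightarrow>
        (\<exists>\<theta>. pair_iso \<theta> B B \<and> (\<forall>x\<in>pverts S. \<theta> (f x) = f (\<phi> x))))"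

end

theory Submission
  imports Defs
begin

text \<open>
  Fix a part \<open>part x \<in> {1..n}\<close> for each vertex \<open>x\<close> of \<open>G\<close>, and let \<open>P = {1..n} \<times> pverts G\<close>, a set of
  ``positions'' in which all \<open>n\<close> columns have the same size. A vertex of the witness is a position
  \<open>p\<close> together with a valuation \<open>\<chi> \<subseteq> P\<close>, that is, one bit for every position. Two such vertices
  \<open>(p, \<chi>)\<close>, \<open>(q, \<xi>)\<close> in different columns are joined according to the sum modulo 2 of the bit of \<open>\<chi>\<close>
  at \<open>q\<close>, the bit of \<open>\<xi>\<close> at \<open>p\<close>, and the bit telling which column comes first; swapping the vertices
  changes exactly the last bit, so precisely one of the two directions is chosen.

  This graph is very symmetric: a permutation of \<open>P\<close> that maps columns to columns induces automorphisms,
  with the freedom to flip, for every pair \<open>{p, q}\<close> of positions in different columns, the bits at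
  \<open>q\<close> of all valuations over \<open>p\<close> as well as the bits at \<open>p\<close> of all valuations over \<open>q\<close>. Only the sum
  of the two flips is prescribed, and it does not depend on the valuations. If one vertex is chosen
  over each of some positions, then the flips can be arranged to take the chosen vertices to any
  other choice that spans the same digraph (lemma \<open>valuation_graph_transversal\<close>).

  The graph \<open>G\<close> sits in the witness with the vertex \<open>x\<close> over the position \<open>(part x, x)\<close>. A partial
  automorphism of \<open>G\<close> preserves non-adjacency, hence being in the same part, so it acts injectively
  on columns and on positions. As the columns have equal size, this action extends to such
  a permutation of \<open>P\<close> (lemma \<open>column_permutation\<close>), which then lifts to an
  automorphism. Vertices over the same position are never adjacent, so no condition arises between
  them; this is what separates the problem from the one for tournaments.
\<close>

section \<open>Partite tournaments and witnesses\<close>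

text \<open>
  A function assigning parts to vertices is handier than a disjoint family of sets, since
  \<open>part u \<noteq> part v\<close> then directly means adjacency.
\<close>

lemma partite_tournament_iff_part:
  "partite_tournament n G \<longleftrightarrow> pair_wf_digraph G \<and>
     (\<exists>part. part ` pverts G \<subseteq> {1..n} \<and>
        (\<forall>u\<in>pverts G. \<forall>v\<in>pverts G.
           if part u = part v then (u, v) \<notin> parcs G
           else ((u, v) \<in> parcs G) \<noteq> ((v, u) \<in> parcs G)))"
    (is "_ \<longleftrightarrow> _ \<and> ?R")
proof (cases "pair_wf_digraph G")
  case wf: True
  show ?thesis
  proof
    assume "partite_tournament n G"
    then obtain V where dis: "disjoint_family_on V {1..n}" and un: "(\<Union>i\<in>{1..n}. V i) = pverts G"
      and same: "\<forall>i\<in>{1..n}. \<forall>u\<in>V i. \<forall>v\<in>V i. (u, v) \<notin> parcs G"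
      and diff: "\<forall>i\<in>{1..n}. \<forall>j\<in>{1..n}. i \<noteq> j \<longrightarrow>
           (\<forall>u\<in>V i. \<forall>v\<in>V j. ((u, v) \<in> parcs G) \<noteq> ((v, u) \<in> parcs G))"
      unfolding partite_tournament_def by blast
    have "\<forall>x\<in>pverts G. \<exists>i. i \<in> {1..n} \<and> x \<in> V i" using un by blast
    then obtain part where part: "\<And>x. x \<in> pverts G \<Longrightarrow> part x \<in> {1..n} \<and> x \<in> V (part x)"
      by metis
    then have "if part u = part v then (u, v) \<notin> parcs G
        else ((u, v) \<in> parcs G) \<noteq> ((v, u) \<in> parcs G)"
      if "u \<in> pverts G" "v \<in> pverts G" for u v
      using same diff that by metis
    then show "pair_wf_digraph G \<and> ?R" using wf part by blast
  next
    assume "pair_wf_digraph G \<and> ?R"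
    then obtain part where im: "part ` pverts G \<subseteq> {1..n}"
      and arc: "\<And>u v. u \<in> pverts G \<Longrightarrow> v \<in> pverts G \<Longrightarrow>
           if part u = part v then (u, v) \<notin> parcs G
           else ((u, v) \<in> parcs G) \<noteq> ((v, u) \<in> parcs G)"
      by blast
    define V where "V i = {x \<in> pverts G. part x = i}" for i
    have "disjoint_family_on V {1..n}" "(\<Union>i\<in>{1..n}. V i) = pverts G"
      using im by (auto simp: V_def disjoint_family_on_def)
    moreover have "\<forall>i\<in>{1..n}. \<forall>u\<in>V i. \<forall>v\<in>V i. (u, v) \<notin> parcs G"
    proof (intro ballI)
      fix i u v assume "u \<in> V i" "v \<in> V i"
      then show "(u, v) \<notin> parcs G" using arc[of u v] by (auto simp: V_def)
    qed
    moreover have "\<forall>i\<in>{1..n}. \<forall>j\<in>{1..n}. i \<noteq> j \<longrightarrow>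
        (\<forall>u\<in>V i. \<forall>v\<in>V j. ((u, v) \<in> parcs G) \<noteq> ((v, u) \<in> parcs G))"
    proof (intro ballI impI)
      fix i j u v assume "i \<noteq> j" "u \<in> V i" "v \<in> V j"
      then show "((u, v) \<in> parcs G) \<noteq> ((v, u) \<in> parcs G)" using arc[of u v] by (auto simp: V_def)
    qed
    ultimately show "partite_tournament n G"
      using wf unfolding partite_tournament_def by blast
  qed
qed (simp add: partite_tournament_def)

text \<open>The copy of \<open>A\<close> in \<open>B\<close> is the subgraph induced on the image of \<open>f\<close>.\<close>

lemma induced_copyI:
  assumes wf: "pair_wf_digraph B"
    and inj: "inj_on f (pverts A)" and im: "f ` pverts A \<subseteq> pverts B"
    and arc: "\<And>u v. u \<in> pverts A \<Longrightarrow> v \<in> pverts A \<Longrightarrow>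
      (u, v) \<in> parcs A \<longleftrightarrow> (f u, f v) \<in> parcs B"
  shows "\<exists>A'. induced_subgraph (with_proj A') (with_proj B) \<and> pair_iso f A A'"
proof -
  interpret B: pair_wf_digraph B by fact
  define A' where "A' = \<lparr>pverts = f ` pverts A,
    parcs = {e \<in> parcs B. fst e \<in> f ` pverts A \<and> snd e \<in> f ` pverts A}\<rparr>"
  have "wf_digraph (with_proj A')"
    by unfold_locales (auto simp: A'_def)
  then have "induced_subgraph (with_proj A') (with_proj B)"
    using B.wf_digraph im
    by (auto simp: induced_subgraph_def subgraph_def A'_def compatible_def)
  moreover have "pair_iso f A A'"
    using inj arc by (auto simp: pair_iso_def A'_def bij_betw_def)
  ultimately show ?thesis by blast
qed

text \<open>
  Replaces induced subgraphs by their vertex sets: a partial automorphism is an injection on a set of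
  vertices that preserves and reflects arcs.
\<close>

lemma EPPA_witnessI:
  assumes wf: "pair_wf_digraph B"
    and inj: "inj_on f (pverts A)" and im: "f ` pverts A \<subseteq> pverts B"
    and arc: "\<And>u v. u \<in> pverts A \<Longrightarrow> v \<in> pverts A \<Longrightarrow>
      (u, v) \<in> parcs A \<longleftrightarrow> (f u, f v) \<in> parcs B"
    and ext: "\<And>X \<phi>. \<lbrakk>X \<subseteq> pverts A; inj_on \<phi> X; \<phi> ` X \<subseteq> pverts A;
        \<And>u v. u \<in> X \<Longrightarrow> v \<in> X \<Longrightarrow> (u, v) \<in> parcs A \<longleftrightarrow> (\<phi> u, \<phi> v) \<in> parcs A\<rbrakk> \<Longrightarrow>
      \<exists>\<theta>. pair_iso \<theta> B B \<and> (\<forall>x\<in>X. \<theta> (f x) = f (\<phi> x))"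
  shows "EPPA_witness f A B"
  unfolding EPPA_witness_def
proof (intro conjI allI impI)
  show "\<exists>A'. induced_subgraph (with_proj A') (with_proj B) \<and> pair_iso f A A'"
    by (rule induced_copyI[OF wf inj im arc])
next
  fix S T \<phi>
  assume "induced_subgraph (with_proj S) (with_proj A) \<and>
    induced_subgraph (with_proj T) (with_proj A) \<and> pair_iso \<phi> S T"
  then have sub: "pverts S \<subseteq> pverts A" "pverts T \<subseteq> pverts A"
    and arcs: "parcs S = {e \<in> parcs A. fst e \<in> pverts S \<and> snd e \<in> pverts S}"
      "parcs T = {e \<in> parcs A. fst e \<in> pverts T \<and> snd e \<in> pverts T}"
    and \<phi>: "inj_on \<phi> (pverts S)" "\<phi> ` pverts S = pverts T"
    and iso: "\<And>u v. u \<in> pverts S \<Longrightarrow> v \<in> pverts S \<Longrightarrow> (u, v) \<in> parcs S \<longleftrightarrow> (\<phi> u, \<phi> v) \<in> parcs T"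
    by (auto simp: induced_subgraph_def subgraph_def pair_iso_def bij_betw_def)
  show "\<exists>\<theta>. pair_iso \<theta> B B \<and> (\<forall>x\<in>pverts S. \<theta> (f x) = f (\<phi> x))"
  proof (rule ext[OF sub(1) \<phi>(1)])
    fix u v assume uv: "u \<in> pverts S" "v \<in> pverts S"
    then have "\<phi> u \<in> pverts T" "\<phi> v \<in> pverts T" using \<phi>(2) by blast+
    then show "(u, v) \<in> parcs A \<longleftrightarrow> (\<phi> u, \<phi> v) \<in> parcs A"
      using iso[OF uv] uv by (simp add: arcs)
  qed (use \<phi> sub in blast)
qed

section \<open>The valuation graph\<close>

text \<open>
  A valuation is the set of positions with bit 1, and \<open>\<noteq>\<close> on truth values is addition modulo 2.
  Columns are numbered so that \<open>fst p < fst q\<close> supplies the one term of the sum that is not symmetric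
  in the two vertices.
\<close>

definition valuation_graph ::
    "(nat \<times> 'b) set \<Rightarrow> ((nat \<times> 'b) \<times> (nat \<times> 'b) set) pair_pre_digraph" where
  "valuation_graph P =
     \<lparr>pverts = P \<times> Pow P,
      parcs = {((p, \<chi>), (q, \<xi>)) | p \<chi> q \<xi>. p \<in> P \<and> q \<in> P \<and> \<chi> \<subseteq> P \<and> \<xi> \<subseteq> P \<and>
        fst p \<noteq> fst q \<and> ((q \<in> \<chi>) \<noteq> ((p \<in> \<xi>) \<noteq> (fst p < fst q)))}\<rparr>"

lemma pverts_valuation_graph [simp]: "pverts (valuation_graph P) = P \<times> Pow P"
  by (simp add: valuation_graph_def)

lemma arc_valuation_graph_iff:
  "((p, \<chi>), (q, \<xi>)) \<in> parcs (valuation_graph P) \<longleftrightarrow> p \<in> P \<and> q \<in> P \<and> \<chi> \<subseteq> P \<and> \<xi> \<subseteq> P \<and>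
     fst p \<noteq> fst q \<and> ((q \<in> \<chi>) \<noteq> ((p \<in> \<xi>) \<noteq> (fst p < fst q)))"
  by (cases p; cases q) (simp add: valuation_graph_def)

lemma partite_tournament_valuation_graph:
  assumes "fst ` P \<subseteq> {1..n}"
  shows "partite_tournament n (valuation_graph P)"
proof -
  have "pair_wf_digraph (valuation_graph P)"
    by unfold_locales (auto simp: valuation_graph_def)
  moreover have "(fst \<circ> fst) ` pverts (valuation_graph P) \<subseteq> {1..n}"
    using assms by auto
  moreover have "if (fst \<circ> fst) u = (fst \<circ> fst) v then (u, v) \<notin> parcs (valuation_graph P)
      else ((u, v) \<in> parcs (valuation_graph P)) \<noteq> ((v, u) \<in> parcs (valuation_graph P))"
    if "u \<in> pverts (valuation_graph P)" "v \<in> pverts (valuation_graph P)" for u v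
    using that by (cases u; cases v) (auto simp: arc_valuation_graph_iff)
  ultimately show ?thesis unfolding partite_tournament_iff_part by blast
qed

text \<open>
  Flipping the bit at \<open>q\<close> of all valuations over \<open>p\<close> whenever \<open>F p q\<close> holds changes the arcs between
  \<open>p\<close> and \<open>q\<close> by \<open>F p q + F q p\<close>. The hypothesis on \<open>F\<close> says that this makes up for \<open>\<pi>\<close> changing the
  order of the two columns.
\<close>

lemma valuation_graph_flip_automorphism:
  assumes fin: "finite P" and bij: "bij_betw \<pi> P P"
    and col: "\<And>p q. p \<in> P \<Longrightarrow> q \<in> P \<Longrightarrow> fst (\<pi> p) = fst (\<pi> q) \<longleftrightarrow> fst p = fst q"
    and F: "\<And>p q. p \<in> P \<Longrightarrow> q \<in> P \<Longrightarrow> fst p \<noteq> fst q \<Longrightarrow>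
      (F p q \<noteq> F q p) = ((fst p < fst q) \<noteq> (fst (\<pi> p) < fst (\<pi> q)))"
  defines "\<theta> \<equiv> \<lambda>(p, \<chi>). (\<pi> p, \<pi> ` {q \<in> P. (q \<in> \<chi>) \<noteq> F p q})"
  shows "pair_iso \<theta> (valuation_graph P) (valuation_graph P)"
proof -
  have inj: "inj_on \<pi> P" and im: "\<pi> ` P = P" using bij by (auto simp: bij_betw_def)
  have mem: "\<pi> q \<in> \<pi> ` {r \<in> P. R r} \<longleftrightarrow> R q" if "q \<in> P" for q R
    using inj that by (auto dest: inj_onD)
  have "inj_on \<theta> (P \<times> Pow P)"
  proof (rule inj_onI)
    fix u v assume uv: "u \<in> P \<times> Pow P" "v \<in> P \<times> Pow P" and eq: "\<theta> u = \<theta> v"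
    obtain p \<chi> q \<xi> where [simp]: "u = (p, \<chi>)" "v = (q, \<xi>)" by (cases u; cases v)
    have [simp]: "q = p" using eq uv inj by (auto simp: \<theta>_def dest: inj_onD)
    have "r \<in> \<chi> \<longleftrightarrow> r \<in> \<xi>" if "r \<in> P" for r
      using eq mem[OF that, of "\<lambda>r. (r \<in> \<chi>) \<noteq> F p r"]
        mem[OF that, of "\<lambda>r. (r \<in> \<xi>) \<noteq> F p r"] by (auto simp: \<theta>_def)
    then show "u = v" using uv by auto
  qed
  moreover have "\<theta> ` (P \<times> Pow P) \<subseteq> P \<times> Pow P" using im by (auto simp: \<theta>_def)
  ultimately have "bij_betw \<theta> (P \<times> Pow P) (P \<times> Pow P)"
    using fin by (simp add: bij_betw_def endo_inj_surj)
  moreover have "(u, v) \<in> parcs (valuation_graph P) \<longleftrightarrow> (\<theta> u, \<theta> v) \<in> parcs (valuation_graph P)"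
    if "u \<in> P \<times> Pow P" "v \<in> P \<times> Pow P" for u v
  proof -
    obtain p \<chi> q \<xi> where [simp]: "u = (p, \<chi>)" "v = (q, \<xi>)" by (cases u; cases v)
    have pq: "p \<in> P" "q \<in> P" "\<chi> \<subseteq> P" "\<xi> \<subseteq> P" using that by auto
    have \<pi>: "\<pi> p \<in> P" "\<pi> q \<in> P" using pq im by auto
    have sub: "\<pi> ` {q \<in> P. R q} \<subseteq> P" for R using im by auto
    show ?thesis
    proof (cases "fst p = fst q")
      case True
      then show ?thesis using col pq by (simp add: \<theta>_def arc_valuation_graph_iff)
    next
      case False
      have "(u, v) \<in> parcs (valuation_graph P) \<longleftrightarrow> (q \<in> \<chi>) \<noteq> ((p \<in> \<xi>) \<noteq> (fst p < fst q))"
        using False pq by (simp add: arc_valuation_graph_iff)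
      moreover have "(\<theta> u, \<theta> v) \<in> parcs (valuation_graph P) \<longleftrightarrow>
          ((q \<in> \<chi>) \<noteq> F p q) \<noteq> (((p \<in> \<xi>) \<noteq> F q p) \<noteq> (fst (\<pi> p) < fst (\<pi> q)))"
        unfolding \<theta>_def using False col[OF pq(1,2)] \<pi> sub
        by (simp add: arc_valuation_graph_iff mem[OF pq(1)] mem[OF pq(2)])
      ultimately show ?thesis using F[OF pq(1,2) False] by argo
    qed
  qed
  ultimately show ?thesis unfolding pair_iso_def by simp
qed

text \<open>
  Moving the chosen vertex over \<open>p \<in> Q\<close> to its target prescribes the flips of all bits over \<open>p\<close>. For
  two positions in \<open>Q\<close> these flips have the right sum because both choices span the same digraph; for
  one position in \<open>Q\<close> the flip over the other position is still free, and it is used to correct the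
  sum.
\<close>

lemma valuation_graph_transversal:
  assumes fin: "finite P" and bij: "bij_betw \<pi> P P"
    and col: "\<And>p q. p \<in> P \<Longrightarrow> q \<in> P \<Longrightarrow> fst (\<pi> p) = fst (\<pi> q) \<longleftrightarrow> fst p = fst q"
    and Q: "Q \<subseteq> P" and c: "\<And>p. p \<in> Q \<Longrightarrow> c p \<subseteq> P" and c': "\<And>p. p \<in> Q \<Longrightarrow> c' p \<subseteq> P"
    and arc: "\<And>p q. p \<in> Q \<Longrightarrow> q \<in> Q \<Longrightarrow>
      ((p, c p), (q, c q)) \<in> parcs (valuation_graph P) \<longleftrightarrow>
      ((\<pi> p, c' p), (\<pi> q, c' q)) \<in> parcs (valuation_graph P)"
  shows "\<exists>\<theta>. pair_iso \<theta> (valuation_graph P) (valuation_graph P) \<and>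
    (\<forall>p\<in>Q. \<theta> (p, c p) = (\<pi> p, c' p))"
proof -
  have im: "\<pi> ` P = P" using bij by (simp add: bij_betw_def)
  define D where "D p q \<longleftrightarrow> (fst p < fst q) \<noteq> (fst (\<pi> p) < fst (\<pi> q))" for p q
  define f where "f p q \<longleftrightarrow> (q \<in> c p) \<noteq> (\<pi> q \<in> c' p)" for p q
  \<comment> \<open>Outside \<open>Q\<close> the whole correction is made over the position in the lower column.\<close>
  define F where "F p q \<longleftrightarrow>
    (if p \<in> Q then f p q else if q \<in> Q then f q p \<noteq> D p q else fst p < fst q \<and> D p q)" for p q
  define \<theta> where "\<theta> = (\<lambda>(p, \<chi>). (\<pi> p, \<pi> ` {q \<in> P. (q \<in> \<chi>) \<noteq> F p q}))"
  have "(F p q \<noteq> F q p) = D p q" if pq: "p \<in> P" "q \<in> P" "fst p \<noteq> fst q" for p q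
  proof -
    have sym: "D q p = D p q" using pq col[of p q] by (auto simp: D_def)
    have *: "\<pi> p \<in> P" "\<pi> q \<in> P" using pq im by auto
    show ?thesis
    proof (cases "p \<in> Q \<and> q \<in> Q")
      case True
      then have "c p \<subseteq> P" "c q \<subseteq> P" "c' p \<subseteq> P" "c' q \<subseteq> P" using c c' by auto
      with True show ?thesis
        using arc[of p q] pq * col[of p q]
        by (simp add: F_def f_def D_def arc_valuation_graph_iff) blast
    next
      case False
      then show ?thesis using sym pq(3) by (auto simp: F_def)
    qed
  qed
  then have "pair_iso \<theta> (valuation_graph P) (valuation_graph P)"
    unfolding \<theta>_def D_def by (intro valuation_graph_flip_automorphism fin bij col)
  moreover have "\<theta> (p, c p) = (\<pi> p, c' p)" if p: "p \<in> Q" for p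
  proof -
    have "{q \<in> P. (q \<in> c p) \<noteq> F p q} = {q \<in> P. \<pi> q \<in> c' p}"
      using p by (auto simp: F_def f_def)
    moreover have "\<pi> ` {q \<in> P. \<pi> q \<in> c' p} = \<pi> ` P \<inter> c' p" by auto
    then have "\<pi> ` {q \<in> P. \<pi> q \<in> c' p} = c' p" using c'[OF p] im by (simp add: Int_absorb1)
    ultimately show ?thesis by (simp add: \<theta>_def)
  qed
  ultimately show ?thesis by blast
qed

section \<open>Extending partial injections\<close>

text \<open>Injectivity makes the complements of \<open>S\<close> and of \<open>f ` S\<close> in the finite set \<open>A\<close> equinumerous.\<close>

lemma partial_injection_extends:
  assumes fin: "finite A" and S: "S \<subseteq> A" and inj: "inj_on f S" and im: "f ` S \<subseteq> A"
  shows "\<exists>g. bij_betw g A A \<and> (\<forall>x\<in>S. g x = f x)"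
proof -
  have "card (A - S) = card (A - f ` S)"
    using fin S im inj by (simp add: card_Diff_subset finite_subset card_image)
  then obtain h where h: "bij_betw h (A - S) (A - f ` S)"
    using fin finite_same_card_bij by blast
  define g where "g x = (if x \<in> S then f x else h x)" for x
  have "bij_betw g S (f ` S)"
    using inj by (auto simp: g_def bij_betw_def inj_on_def)
  moreover have "bij_betw g (A - S) (A - f ` S)"
    using h by (subst bij_betw_cong[where g = h]) (auto simp: g_def)
  ultimately have "bij_betw g (S \<union> (A - S)) (f ` S \<union> (A - f ` S))"
    by (rule bij_betw_combine) auto
  then have "bij_betw g A A" using S im by (simp add: Un_absorb1)
  then show ?thesis by (auto simp: g_def)
qed

text \<open>
  The columns of \<open>I \<times> A\<close> are permuted by an extension \<open>\<sigma>\<close> of the action of \<open>\<phi>\<close> on parts, and the column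
  \<open>i\<close> is mapped to the column \<open>\<sigma> i\<close> by an extension of the restriction of \<open>\<phi>\<close> to the part \<open>i\<close>. Both
  exist since all columns are copies of the same set \<open>A\<close>.
\<close>

lemma column_permutation:
  assumes fin: "finite I" "finite A"
    and X: "X \<subseteq> A" and inj: "inj_on \<phi> X" and im: "\<phi> ` X \<subseteq> A" and part: "part ` A \<subseteq> I"
    and pres: "\<And>x y. x \<in> X \<Longrightarrow> y \<in> X \<Longrightarrow> part (\<phi> x) = part (\<phi> y) \<longleftrightarrow> part x = part y"
  shows "\<exists>\<pi>. bij_betw \<pi> (I \<times> A) (I \<times> A) \<and>
    (\<forall>p\<in>I \<times> A. \<forall>q\<in>I \<times> A. fst (\<pi> p) = fst (\<pi> q) \<longleftrightarrow> fst p = fst q) \<and>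
    (\<forall>x\<in>X. \<pi> (part x, x) = (part (\<phi> x), \<phi> x))"
proof -
  define s where "s i = part (\<phi> (SOME x. x \<in> X \<and> part x = i))" for i
  have s: "s (part x) = part (\<phi> x)" if "x \<in> X" for x
  proof -
    have "(SOME y. y \<in> X \<and> part y = part x) \<in> X \<and>
        part (SOME y. y \<in> X \<and> part y = part x) = part x"
      using that by (intro someI[where P = "\<lambda>y. y \<in> X \<and> part y = part x"]) simp
    then show ?thesis unfolding s_def using pres that by blast
  qed
  have "\<exists>\<sigma>. bij_betw \<sigma> I I \<and> (\<forall>i\<in>part ` X. \<sigma> i = s i)"
  proof (rule partial_injection_extends[OF fin(1)])
    show "part ` X \<subseteq> I" using X part by blast
    show "inj_on s (part ` X)" using pres by (auto intro!: inj_onI simp: s)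
    show "s ` part ` X \<subseteq> I"
    proof (intro subsetI; elim imageE)
      fix i j x assume "i = s j" "j = part x" "x \<in> X"
      then show "i \<in> I" using im part s[of x] by auto
    qed
  qed
  then obtain \<sigma> where \<sigma>: "bij_betw \<sigma> I I" "\<forall>i\<in>part ` X. \<sigma> i = s i"
    by blast
  have \<sigma>_part: "\<sigma> (part x) = part (\<phi> x)" if "x \<in> X" for x
    using that \<sigma>(2) s by simp
  have "\<exists>t. bij_betw t A A \<and> (\<forall>x\<in>{x \<in> X. part x = i}. t x = \<phi> x)" for i
  proof (rule partial_injection_extends[OF fin(2)])
    show "inj_on \<phi> {x \<in> X. part x = i}" using inj by (rule inj_on_subset) blast
  qed (use X im in blast)+
  then obtain \<tau> where \<tau>: "\<And>i. bij_betw (\<tau> i) A A"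
      "\<And>i. \<forall>x\<in>{x \<in> X. part x = i}. \<tau> i x = \<phi> x"
    by metis
  define \<pi> where "\<pi> = (\<lambda>(i, x). (\<sigma> i, \<tau> i x))"
  have "\<sigma> i = \<sigma> j \<longleftrightarrow> i = j" if "i \<in> I" "j \<in> I" for i j
    using inj_on_eq_iff[OF bij_betw_imp_inj_on[OF \<sigma>(1)]] that .
  then have col: "\<forall>p\<in>I \<times> A. \<forall>q\<in>I \<times> A. fst (\<pi> p) = fst (\<pi> q) \<longleftrightarrow> fst p = fst q"
    by (auto simp: \<pi>_def)
  have "inj_on \<pi> (I \<times> A)"
  proof (rule inj_onI)
    fix p q assume pq: "p \<in> I \<times> A" "q \<in> I \<times> A" "\<pi> p = \<pi> q"
    have "fst p = fst q" using col pq by metis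
    moreover from this have "snd p = snd q"
      using pq inj_onD[OF bij_betw_imp_inj_on[OF \<tau>(1)], of "fst p" "snd p" "snd q"]
      by (auto simp: \<pi>_def split_beta)
    ultimately show "p = q" by (rule prod_eqI)
  qed
  moreover have "\<pi> ` (I \<times> A) \<subseteq> I \<times> A"
    using bij_betwE[OF \<sigma>(1)] bij_betwE[OF \<tau>(1)] by (auto simp: \<pi>_def)
  ultimately have "bij_betw \<pi> (I \<times> A) (I \<times> A)"
    using fin by (simp add: bij_betw_def endo_inj_surj)
  with col show ?thesis using \<sigma>_part \<tau>(2) by (auto simp: \<pi>_def)
qed

section \<open>The valuation graph as a witness\<close>

lemma partite_tournament_EPPA_valuation_graph:
  assumes G: "partite_tournament n G" and fin: "finite (pverts G)"
  shows "\<exists>f. EPPA_witness f G (valuation_graph ({1..n} \<times> pverts G))"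
proof -
  obtain part where part: "part ` pverts G \<subseteq> {1..n}"
    and arc: "\<And>u v. u \<in> pverts G \<Longrightarrow> v \<in> pverts G \<Longrightarrow>
      if part u = part v then (u, v) \<notin> parcs G
      else ((u, v) \<in> parcs G) \<noteq> ((v, u) \<in> parcs G)"
    using G unfolding partite_tournament_iff_part by blast
  define P where "P = {1..n} \<times> pverts G"
  define B where "B = valuation_graph P"
  define pos where "pos x = (part x, x)" for x
  \<comment> \<open>For each pair of adjacent vertices, the one in the higher part records the direction.\<close>
  define val where "val x = pos ` {y \<in> pverts G. part y < part x \<and> (x, y) \<in> parcs G}" for x
  define f where "f x = (pos x, val x)" for x
  have pos: "pos x \<in> P" if "x \<in> pverts G" for x using part that by (auto simp: P_def pos_def)
  have val: "val x \<subseteq> P" for x using pos by (auto simp: val_def)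
  have pos_val: "pos y \<in> val x \<longleftrightarrow> part y < part x \<and> (x, y) \<in> parcs G" if "y \<in> pverts G" for x y
    using that by (auto simp: val_def pos_def)
  have arc_f: "(u, v) \<in> parcs G \<longleftrightarrow> (f u, f v) \<in> parcs B"
    if uv: "u \<in> pverts G" "v \<in> pverts G" for u v
  proof -
    have "(f u, f v) \<in> parcs B \<longleftrightarrow> part u \<noteq> part v \<and>
        ((part v < part u \<and> (u, v) \<in> parcs G) \<noteq>
          ((part u < part v \<and> (v, u) \<in> parcs G) \<noteq> (part u < part v)))"
      using uv by (simp add: f_def B_def arc_valuation_graph_iff pos val pos_val) (simp add: pos_def)
    also have "\<dots> \<longleftrightarrow> (u, v) \<in> parcs G"
      using arc[OF uv] by (cases "part u" "part v" rule: linorder_cases) auto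
    finally show ?thesis by simp
  qed
  have "EPPA_witness f G B"
  proof (rule EPPA_witnessI)
    have "fst ` P \<subseteq> {1..n}" by (auto simp: P_def)
    then show "pair_wf_digraph B"
      using partite_tournament_valuation_graph unfolding B_def partite_tournament_def by blast
  next
    show "inj_on f (pverts G)" by (auto simp: f_def pos_def inj_on_def)
    show "f ` pverts G \<subseteq> pverts B" using pos val by (auto simp: f_def B_def)
  next
    fix X \<phi>
    assume X: "X \<subseteq> pverts G" and inj: "inj_on \<phi> X" and im: "\<phi> ` X \<subseteq> pverts G"
      and iso: "\<And>u v. u \<in> X \<Longrightarrow> v \<in> X \<Longrightarrow> (u, v) \<in> parcs G \<longleftrightarrow> (\<phi> u, \<phi> v) \<in> parcs G"
    have pres: "part (\<phi> x) = part (\<phi> y) \<longleftrightarrow> part x = part y" if xy: "x \<in> X" "y \<in> X" for x y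
    proof -
      have "x \<in> pverts G" "y \<in> pverts G" "\<phi> x \<in> pverts G" "\<phi> y \<in> pverts G"
        using xy X im by auto
      then show ?thesis
        using iso[OF xy] iso[OF xy(2,1)] arc[of x y] arc[of y x] arc[of "\<phi> x" "\<phi> y"]
          arc[of "\<phi> y" "\<phi> x"] by metis
    qed
    have "\<exists>\<pi>. bij_betw \<pi> P P \<and>
        (\<forall>p\<in>P. \<forall>q\<in>P. fst (\<pi> p) = fst (\<pi> q) \<longleftrightarrow> fst p = fst q) \<and>
        (\<forall>x\<in>X. \<pi> (pos x) = pos (\<phi> x))"
      unfolding P_def pos_def using fin
      by (intro column_permutation X inj im part pres) auto
    then obtain \<pi> where bij: "bij_betw \<pi> P P"
      and col: "\<And>p q. p \<in> P \<Longrightarrow> q \<in> P \<Longrightarrow> fst (\<pi> p) = fst (\<pi> q) \<longleftrightarrow> fst p = fst q"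
      and \<pi>: "\<And>x. x \<in> X \<Longrightarrow> \<pi> (pos x) = pos (\<phi> x)"
      by blast
    have snd_pos: "snd (pos x) = x" for x by (simp add: pos_def)
    have "\<exists>\<theta>. pair_iso \<theta> B B \<and>
        (\<forall>p\<in>pos ` X. \<theta> (p, val (snd p)) = (\<pi> p, val (\<phi> (snd p))))"
      unfolding B_def
    proof (rule valuation_graph_transversal[OF _ bij col])
      show "finite P" using fin by (simp add: P_def)
      show "pos ` X \<subseteq> P" using pos X by auto
      fix p q assume "p \<in> pos ` X" "q \<in> pos ` X"
      then obtain x y where xy: "x \<in> X" "y \<in> X" and [simp]: "p = pos x" "q = pos y" by auto
      have "(f x, f y) \<in> parcs B \<longleftrightarrow> (f (\<phi> x), f (\<phi> y)) \<in> parcs B"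
        using arc_f[of x y] arc_f[of "\<phi> x" "\<phi> y"] iso[OF xy] xy X im by blast
      then show "((p, val (snd p)), (q, val (snd q))) \<in> parcs (valuation_graph P) \<longleftrightarrow>
          ((\<pi> p, val (\<phi> (snd p))), (\<pi> q, val (\<phi> (snd q)))) \<in> parcs (valuation_graph P)"
        using \<pi> xy by (simp add: f_def snd_pos B_def)
    qed (use val in auto)
    then show "\<exists>\<theta>. pair_iso \<theta> B B \<and> (\<forall>x\<in>X. \<theta> (f x) = f (\<phi> x))"
      using \<pi> by (auto simp: f_def snd_pos)
  qed (fact arc_f)
  then show ?thesis unfolding B_def P_def by blast
qed

section \<open>Transport along isomorphisms\<close>

lemma pair_iso_comp:
  assumes f: "pair_iso f G H" and g: "pair_iso g H K"
  shows "pair_iso (g \<circ> f) G K"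
proof -
  have "bij_betw (g \<circ> f) (pverts G) (pverts K)"
    using f g by (auto simp: pair_iso_def intro: bij_betw_trans)
  moreover have "f u \<in> pverts H" if "u \<in> pverts G" for u
    using f that by (auto simp: pair_iso_def dest: bij_betwE)
  ultimately show ?thesis using f g by (simp add: pair_iso_def)
qed

lemma pair_iso_inv_into:
  assumes "pair_iso g H K"
  shows "pair_iso (inv_into (pverts H) g) K H"
proof -
  have bij: "bij_betw g (pverts H) (pverts K)"
    and arc: "\<And>u v. u \<in> pverts H \<Longrightarrow> v \<in> pverts H \<Longrightarrow> (u, v) \<in> parcs H \<longleftrightarrow> (g u, g v) \<in> parcs K"
    using assms by (auto simp: pair_iso_def)
  have inv: "inv_into (pverts H) g u \<in> pverts H" "g (inv_into (pverts H) g u) = u"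
    if "u \<in> pverts K" for u
    using bij that by (auto simp: bij_betw_def inv_into_into f_inv_into_f)
  then show ?thesis
    using arc bij_betw_inv_into[OF bij] by (simp add: pair_iso_def)
qed

lemma partite_tournament_pair_iso:
  assumes H: "partite_tournament n H" and K: "pair_wf_digraph K" and iso: "pair_iso g K H"
  shows "partite_tournament n K"
proof -
  obtain part where part: "part ` pverts H \<subseteq> {1..n}"
    and arc: "\<And>u v. u \<in> pverts H \<Longrightarrow> v \<in> pverts H \<Longrightarrow>
      if part u = part v then (u, v) \<notin> parcs H
      else ((u, v) \<in> parcs H) \<noteq> ((v, u) \<in> parcs H)"
    using H unfolding partite_tournament_iff_part by blast
  have g: "g u \<in> pverts H" if "u \<in> pverts K" for u
    using iso that by (auto simp: pair_iso_def dest: bij_betwE)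
  have "(part \<circ> g) ` pverts K \<subseteq> {1..n}" using part g by auto
  moreover have "if (part \<circ> g) u = (part \<circ> g) v then (u, v) \<notin> parcs K
      else ((u, v) \<in> parcs K) \<noteq> ((v, u) \<in> parcs K)"
    if "u \<in> pverts K" "v \<in> pverts K" for u v
    using arc[of "g u" "g v"] g iso that by (auto simp: pair_iso_def)
  ultimately show ?thesis using K unfolding partite_tournament_iff_part by blast
qed

text \<open>
  Partial automorphisms live on \<open>A\<close> and are unaffected by the change of the witness; their extensions
  are conjugated by \<open>g\<close>.
\<close>

lemma EPPA_witness_pair_iso:
  assumes wit: "EPPA_witness f A B" and K: "pair_wf_digraph K" and iso: "pair_iso g B K"
  shows "EPPA_witness (g \<circ> f) A K"
  unfolding EPPA_witness_def
proof (intro conjI allI impI)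
  obtain A' where A': "induced_subgraph (with_proj A') (with_proj B)" and fA: "pair_iso f A A'"
    using wit unfolding EPPA_witness_def by blast
  have sub: "pverts A' \<subseteq> pverts B"
    and arcs: "parcs A' = {e \<in> parcs B. fst e \<in> pverts A' \<and> snd e \<in> pverts A'}"
    using A' by (auto simp: induced_subgraph_def subgraph_def)
  have f: "inj_on f (pverts A)" "f ` pverts A = pverts A'"
    and f_arc: "\<And>u v. u \<in> pverts A \<Longrightarrow> v \<in> pverts A \<Longrightarrow> (u, v) \<in> parcs A \<longleftrightarrow> (f u, f v) \<in> parcs A'"
    using fA by (auto simp: pair_iso_def bij_betw_def)
  have g: "inj_on g (pverts B)" "g ` pverts B = pverts K"
    and g_arc: "\<And>u v. u \<in> pverts B \<Longrightarrow> v \<in> pverts B \<Longrightarrow> (u, v) \<in> parcs B \<longleftrightarrow> (g u, g v) \<in> parcs K"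
    using iso by (auto simp: pair_iso_def bij_betw_def)
  show "\<exists>A'. induced_subgraph (with_proj A') (with_proj K) \<and> pair_iso (g \<circ> f) A A'"
  proof (rule induced_copyI[OF K])
    show "inj_on (g \<circ> f) (pverts A)"
      using f g(1) sub by (metis comp_inj_on inj_on_subset)
    show "(g \<circ> f) ` pverts A \<subseteq> pverts K" using f g sub by auto
    fix u v assume uv: "u \<in> pverts A" "v \<in> pverts A"
    then have "f u \<in> pverts A'" "f v \<in> pverts A'" using f by auto
    then show "(u, v) \<in> parcs A \<longleftrightarrow> ((g \<circ> f) u, (g \<circ> f) v) \<in> parcs K"
      using f_arc[OF uv] g_arc[of "f u" "f v"] sub arcs by auto
  qed
  fix S T \<phi>
  assume S: "induced_subgraph (with_proj S) (with_proj A) \<and>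
    induced_subgraph (with_proj T) (with_proj A) \<and> pair_iso \<phi> S T"
  then obtain \<theta> where \<theta>: "pair_iso \<theta> B B" "\<And>x. x \<in> pverts S \<Longrightarrow> \<theta> (f x) = f (\<phi> x)"
    using wit unfolding EPPA_witness_def by blast
  let ?h = "inv_into (pverts B) g"
  have "pair_iso (g \<circ> (\<theta> \<circ> ?h)) K K"
    by (rule pair_iso_comp[OF pair_iso_comp[OF pair_iso_inv_into[OF iso] \<theta>(1)] iso])
  moreover have "(g \<circ> (\<theta> \<circ> ?h)) ((g \<circ> f) x) = (g \<circ> f) (\<phi> x)" if x: "x \<in> pverts S" for x
  proof -
    have "x \<in> pverts A" using S x by (auto simp: induced_subgraph_def subgraph_def)
    then have "f x \<in> pverts B" using f sub by auto
    then show ?thesis using g \<theta>(2)[OF x] by (simp add: inv_into_f_f)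
  qed
  ultimately show "\<exists>\<theta>. pair_iso \<theta> K K \<and> (\<forall>x\<in>pverts S. \<theta> ((g \<circ> f) x) = (g \<circ> f) (\<phi> x))"
    by blast
qed

lemma finite_graph_nat_copy:
  fixes B :: "'b pair_pre_digraph"
  assumes wf: "pair_wf_digraph B" and fin: "finite (pverts B)"
  shows "\<exists>(K :: nat pair_pre_digraph) g. pair_wf_digraph K \<and> finite (pverts K) \<and> pair_iso g B K"
proof -
  interpret B: pair_wf_digraph B by fact
  have sub: "u \<in> pverts B \<and> v \<in> pverts B" if "(u, v) \<in> parcs B" for u v
    using B.wellformed'[OF that] by simp
  obtain g :: "'b \<Rightarrow> nat" where g: "inj_on g (pverts B)"
    using finite_imp_inj_to_nat_seg[OF fin] by blast
  define K where "K = \<lparr>pverts = g ` pverts B, parcs = map_prod g g ` parcs B\<rparr>"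
  have "pair_wf_digraph K"
    by unfold_locales (auto simp: K_def dest: sub)
  moreover have "(u, v) \<in> parcs B \<longleftrightarrow> (g u, g v) \<in> parcs K"
    if "u \<in> pverts B" "v \<in> pverts B" for u v
  proof
    assume "(g u, g v) \<in> parcs K"
    then obtain u' v' where *: "(u', v') \<in> parcs B" "g u = g u'" "g v = g v'"
      by (auto simp: K_def)
    then have "u = u'" "v = v'" using inj_onD[OF g] sub[OF *(1)] that by auto
    with * show "(u, v) \<in> parcs B" by simp
  qed (force simp: K_def)
  then have "pair_iso g B K" using g by (simp add: pair_iso_def K_def bij_betw_def)
  ultimately show ?thesis using fin by (auto simp: K_def)
qed

section \<open>EPPA for partite tournaments\<close>

theorem theorem1:
  fixes n :: nat and G :: "'a pair_pre_digraph"
  assumes "n \<ge> 2" and "partite_tournament n G" and "finite (pverts G)"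
  shows "\<exists>(H :: nat pair_pre_digraph) f.
           partite_tournament n H \<and> finite (pverts H) \<and> EPPA_witness f G H"
proof -
  define B where "B = valuation_graph ({1..n} \<times> pverts G)"
  have B: "partite_tournament n B"
    unfolding B_def by (rule partite_tournament_valuation_graph) auto
  obtain f where f: "EPPA_witness f G B"
    using partite_tournament_EPPA_valuation_graph[OF assms(2,3)] unfolding B_def by blast
  have "finite (pverts B)" using assms(3) by (simp add: B_def)
  moreover have "pair_wf_digraph B" using B by (simp add: partite_tournament_def)
  ultimately obtain H :: "nat pair_pre_digraph" and g
    where H: "pair_wf_digraph H" "finite (pverts H)" "pair_iso g B H"
    using finite_graph_nat_copy by blast
  have "partite_tournament n H"
    using B H(1) pair_iso_inv_into[OF H(3)] by (rule partite_tournament_pair_iso)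
  moreover have "EPPA_witness (g \<circ> f) G H"
    using f H(1,3) by (rule EPPA_witness_pair_iso)
  ultimately show ?thesis using H(2) by blast
qed

end
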